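(* For each $n$ let $G_n$ be an interval graph with $n$ vertices, defined by closed intervals $I_{ni}=[a_{ni},b_{ni}]\subseteq[0,1]$, $i=1,\dots,n$. Suppose that, as $n\to\infty$, the empirical measure $$\mu_n=\frac1n\sum_{i=1}^n\delta_{I_{ni}}\in\mathcal P(\mathcal S)$$ converges weakly to a measure $\mu\in\mathcal P(\mathcal S)$, and suppose further that $\mu_L$ and $\mu_R$ have no common atom. Then $G_n$ converges to the graph limit $\Gamma_\mu$.
   Context: Graphs are finite, simple and undirected; $|G|$ is the number of vertices. The graph defined by intervals $I_1,\dots,I_n$ has vertex set $\{1,\dots,n\}$ and an edge $ij$ ($i\ne j$) if and only if $I_i\cap I_j\ne\emptyset$; such graphs are interval graphs. For graphs $F,G$, $t(F,G)$ is the probability that a uniformly random map $V(F)\to V(G)$ is a graph homomorphism. A graph limit $\Gamma$ is the limit of a sequence of graphs $G_n$ with $|G_n|\to\infty$ for which $t(F,G_n)$ converges for every graph $F$; it is determined by the numbers $t(F,\Gamma)=\lim_n t(F,G_n)$. We write $G_n\to\Gamma$ ("$G_n$ converges to $\Gamma$") if $|G_n|\to\infty$ and $t(F,G_n)\to t(F,\Gamma)$ for every graph $F$. $\mathcal S=\{[a,b]:0\le a\le b\le1\}$ is the set of non-empty closed subintervals of $[0,1]$ (length $0$ allowed), identified with the compact triangle $\{(a,b):0\le a\le b\le 1\}\subset\mathbb R^2$. $W(I,J)=1$ if $I\cap J\ne\emptyset$ and $0$ otherwise, for $I,J\in\mathcal S$. $\mathcal P(\mathcal S)$ is the set of Borel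 probability measures on $\mathcal S$ with the weak topology. For $\mu\in\mathcal P(\mathcal S)$, $\Gamma_\mu$ is the unique graph limit with $$t(F,\Gamma_\mu)=\int_{\mathcal S^{|F|}}\prod_{ij\in E(F)}W(x_i,x_j)\,d\mu(x_1)\cdots d\mu(x_{|F|})\quad\text{for every graph }F.$$ $\mu_L$ and $\mu_R$ are the images of $\mu$ under $[a,b]\mapsto a$ and $[a,b]\mapsto b$, respectively (measures on $[0,1]$). A common atom is a point $c$ with $\mu_L\{c\}>0$ and $\mu_R\{c\}>0$. *)

theory Defs
  imports "HOL-Probability.Probability"
begin

section \<open>Finite simple graphs and homomorphism densities\<close>

text \<open>
  Vertices are natural numbers: every finite graph has an isomorphic copy of this kind, and
  homomorphism densities are invariant under isomorphism.
\<close>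

typedef graph =
  "{(V :: nat set, E :: nat set set). finite V \<and> (\<forall>e\<in>E. e \<subseteq> V \<and> card e = 2)}"
  by (rule exI[of _ "({}, {})"]) simp

definition verts :: "graph \<Rightarrow> nat set" where
  "verts G = fst (Rep_graph G)"

definition edges :: "graph \<Rightarrow> nat set set" where
  "edges G = snd (Rep_graph G)"

definition graph_order :: "graph \<Rightarrow> nat" where
  "graph_order G = card (verts G)"

definition homs :: "graph \<Rightarrow> graph \<Rightarrow> (nat \<Rightarrow> nat) set" where
  "homs F G = {\<phi> \<in> verts F \<rightarrow>\<^sub>E verts G. \<forall>i j. {i, j} \<in> edges F \<longrightarrow> {\<phi> i, \<phi> j} \<in> edges G}"

definition hom_density :: "graph \<Rightarrow> graph \<Rightarrow> real" where
  "hom_density F G = measure (uniform_count_measure (verts F \<rightarrow>\<^sub>E verts G)) (homs F G)"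

lemma finite_verts: "finite (verts G)"
  using Rep_graph[of G] by (auto simp: verts_def)

lemma edgeD:
  assumes "e \<in> edges G"
  shows "e \<subseteq> verts G" and "card e = 2"
  using Rep_graph[of G] assms by (auto simp: verts_def edges_def split_beta)

lemma hom_density_eq_card:
  "hom_density F G = real (card (homs F G)) / real (card (verts F \<rightarrow>\<^sub>E verts G))"
  unfolding hom_density_def
  by (rule measure_uniform_count_measure)
     (auto simp: homs_def intro: finite_PiE finite_verts)


section \<open>Graph limits\<close>

text \<open>
  A graph limit is determined by its densities, so it is represented by the function
  \<open>F \<mapsto> t(F, \<Gamma>)\<close>; the functions that occur are exactly the pointwise limits of
  \<open>F \<mapsto> t(F, G\<^sub>n)\<close> along graph sequences whose order tends to infinity.
\<close>

lemma edgeless: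
  defines "D \<equiv> \<lambda>n. Abs_graph ({1..n}, {})"
  shows "verts (D n) = {1..n}" and "edges (D n) = {}"
  by (simp_all add: D_def verts_def edges_def Abs_graph_inverse)

lemma hom_density_edgeless:
  assumes "n \<ge> 1"
  shows "hom_density F (Abs_graph ({1..n}, {})) = (if edges F = {} then 1 else 0)"
proof (cases "edges F = {}")
  case True
  have "card (verts F \<rightarrow>\<^sub>E {1..n}) \<noteq> 0"
    using assms by (simp add: card_PiE finite_verts)
  moreover have "homs F (Abs_graph ({1..n}, {})) = verts F \<rightarrow>\<^sub>E {1..n}"
    using True unfolding homs_def edgeless by simp
  ultimately show ?thesis
    using True unfolding hom_density_eq_card edgeless by simp
next
  case False
  then obtain e where e: "e \<in> edges F" by blast
  then obtain i j where "e = {i, j}"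
    using edgeD(2)[OF e] by (auto simp: card_2_iff)
  with e have "homs F (Abs_graph ({1..n}, {})) = {}"
    unfolding homs_def edgeless by auto
  with False show ?thesis by (simp add: hom_density_eq_card)
qed

typedef graph_limit =
  "{\<tau> :: graph \<Rightarrow> real. \<exists>G :: nat \<Rightarrow> graph.
      filterlim (\<lambda>n. graph_order (G n)) at_top sequentially \<and>
      (\<forall>F. (\<lambda>n. hom_density F (G n)) \<longlonglongrightarrow> \<tau> F)}"
proof -
  define D where "D n = Abs_graph ({1..n}, {})" for n :: nat
  have "filterlim (\<lambda>n. graph_order (D n)) at_top sequentially"
    unfolding D_def graph_order_def edgeless by (simp add: filterlim_ident)
  moreover have "(\<lambda>n. hom_density F (D n)) \<longlonglongrightarrow> (if edges F = {} then 1 else 0)" for F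
    by (rule tendsto_eventually)
       (unfold D_def, rule eventually_sequentiallyI[of 1], rule hom_density_edgeless)
  ultimately show ?thesis
    by (intro exI[of _ "\<lambda>F. if edges F = {} then 1 else 0"]) blast
qed

definition limit_density :: "graph \<Rightarrow> graph_limit \<Rightarrow> real" where
  "limit_density F \<Gamma> = Rep_graph_limit \<Gamma> F"

definition converges_to :: "(nat \<Rightarrow> graph) \<Rightarrow> graph_limit \<Rightarrow> bool" where
  "converges_to G \<Gamma> \<longleftrightarrow>
     filterlim (\<lambda>n. graph_order (G n)) at_top sequentially \<and>
     (\<forall>F. (\<lambda>n. hom_density F (G n)) \<longlonglongrightarrow> limit_density F \<Gamma>)"

lemma graph_limit_eqI: "(\<And>F. limit_density F \<Gamma> = limit_density F \<Delta>) \<Longrightarrow> \<Gamma> = \<Delta>"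
  by (metis Rep_graph_limit_inject ext limit_density_def)


section \<open>Interval graphs\<close>

definition interval_graph :: "nat \<Rightarrow> (nat \<Rightarrow> real set) \<Rightarrow> graph" where
  "interval_graph n I =
     Abs_graph ({1..n}, {{i, j} | i j. i \<in> {1..n} \<and> j \<in> {1..n} \<and> i \<noteq> j \<and> I i \<inter> I j \<noteq> {}})"

lemma verts_interval_graph: "verts (interval_graph n I) = {1..n}"
  and edges_interval_graph: "edges (interval_graph n I) =
    {{i, j} | i j. i \<in> {1..n} \<and> j \<in> {1..n} \<and> i \<noteq> j \<and> I i \<inter> I j \<noteq> {}}"
  unfolding verts_def edges_def interval_graph_def
  by (subst Abs_graph_inverse; auto)+


section \<open>Measures on the space of intervals\<close>

text \<open>The interval \<open>[a, b]\<close> is identified with the pair \<open>(a, b)\<close>.\<close>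

definition intervals :: "(real \<times> real) set" where
  "intervals = {(a, b). 0 \<le> a \<and> a \<le> b \<and> b \<le> 1}"

definition borel_intervals :: "(real \<times> real) measure" where
  "borel_intervals = restrict_space borel intervals"

text \<open>The Borel probability measures on \<open>intervals\<close> are the elements of
  \<open>space (prob_algebra borel_intervals)\<close>.\<close>

definition W :: "real \<times> real \<Rightarrow> real \<times> real \<Rightarrow> real" where
  "W I J = (if {fst I..snd I} \<inter> {fst J..snd J} \<noteq> {} then 1 else 0)"

text \<open>\<open>W\<close> is symmetric, so each edge of \<open>F\<close> contributes one factor, taken with its
  endpoints in increasing order.\<close>

definition interval_density :: "graph \<Rightarrow> (real \<times> real) measure \<Rightarrow> real" where
  "interval_density F \<mu> =
     (\<integral>x. (\<Prod>(i, j) \<in> {(i, j). i < j \<and> {i, j} \<in> edges F}. W (x i) (x j))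
        \<partial>(Pi\<^sub>M (verts F) (\<lambda>_. \<mu>)))"

text \<open>At most one graph limit has given densities (\<open>graph_limit_eqI\<close>). That one with
  these densities exists for every Borel probability measure on \<open>intervals\<close> is the
  standard fact about \<open>W\<close>-random graphs; it is not proved here.\<close>

definition interval_limit :: "(real \<times> real) measure \<Rightarrow> graph_limit" where
  "interval_limit \<mu> = (THE \<Gamma>. \<forall>F. limit_density F \<Gamma> = interval_density F \<mu>)"

definition left_marginal :: "(real \<times> real) measure \<Rightarrow> real measure" where
  "left_marginal \<mu> = distr \<mu> (restrict_space borel {0..1}) fst"

definition right_marginal :: "(real \<times> real) measure \<Rightarrow> real measure" where
  "right_marginal \<mu> = distr \<mu> (restrict_space borel {0..1}) snd"

lemma measure_marginals:
  assumes "sets \<mu> = sets borel_intervals" and "c \<in> {0..1}"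
  shows "measure (left_marginal \<mu>) {c} = measure \<mu> {x \<in> intervals. fst x = c}"
    and "measure (right_marginal \<mu>) {c} = measure \<mu> {x \<in> intervals. snd x = c}"
proof -
  have sp: "space \<mu> = intervals"
    using sets_eq_imp_space_eq[OF assms(1)]
    by (simp add: borel_intervals_def space_restrict_space)
  have c: "{c} \<in> sets (restrict_space borel {0..1})"
    using assms(2) by (simp add: sets_restrict_space_iff)
  have "fst \<in> restrict_space borel intervals \<rightarrow>\<^sub>M restrict_space (borel :: real measure) {0..1}"
    by (intro measurable_restrict_space3 borel_measurable_continuous_onI continuous_intros)
       (auto simp: intervals_def)
  then have f: "fst \<in> \<mu> \<rightarrow>\<^sub>M restrict_space borel {0..1}"
    using assms(1) measurable_cong_sets[of \<mu> "restrict_space borel intervals"]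
    by (auto simp: borel_intervals_def)
  have "snd \<in> restrict_space borel intervals \<rightarrow>\<^sub>M restrict_space (borel :: real measure) {0..1}"
    by (intro measurable_restrict_space3 borel_measurable_continuous_onI continuous_intros)
       (auto simp: intervals_def)
  then have g: "snd \<in> \<mu> \<rightarrow>\<^sub>M restrict_space borel {0..1}"
    using assms(1) measurable_cong_sets[of \<mu> "restrict_space borel intervals"]
    by (auto simp: borel_intervals_def)
  show "measure (left_marginal \<mu>) {c} = measure \<mu> {x \<in> intervals. fst x = c}"
    unfolding left_marginal_def measure_distr[OF f c]
    by (rule arg_cong[of _ _ "measure \<mu>"]) (auto simp: sp)
  show "measure (right_marginal \<mu>) {c} = measure \<mu> {x \<in> intervals. snd x = c}"
    unfolding right_marginal_def measure_distr[OF g c]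
    by (rule arg_cong[of _ _ "measure \<mu>"]) (auto simp: sp)
qed

definition common_atom :: "(real \<times> real) measure \<Rightarrow> real \<Rightarrow> bool" where
  "common_atom \<mu> c \<longleftrightarrow> measure (left_marginal \<mu>) {c} > 0 \<and> measure (right_marginal \<mu>) {c} > 0"

text \<open>\<open>return borel_intervals x\<close> is the Dirac measure at \<open>x\<close>.\<close>

definition empirical_measure :: "nat \<Rightarrow> (nat \<Rightarrow> real \<times> real) \<Rightarrow> (real \<times> real) measure" where
  "empirical_measure n I =
     measure_of (space borel_intervals) (sets borel_intervals)
       (\<lambda>A. (\<Sum>i = 1..n. emeasure (return borel_intervals (I i)) A) / of_nat n)"

lemma sets_empirical_measure: "sets (empirical_measure n I) = sets borel_intervals"
  by (simp add: empirical_measure_def)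

lemma emeasure_empirical_measure:
  assumes "A \<in> sets borel_intervals"
  shows "emeasure (empirical_measure n I) A =
    (\<Sum>i = 1..n. emeasure (return borel_intervals (I i)) A) / of_nat n"
proof (rule emeasure_measure_of[OF empirical_measure_def])
  show "sets borel_intervals \<subseteq> Pow (space borel_intervals)"
    by (rule sets.space_closed)
  show "A \<in> sets (empirical_measure n I)"
    using assms by (simp add: sets_empirical_measure)
  show "positive (sets (empirical_measure n I))
      (\<lambda>A. (\<Sum>i = 1..n. emeasure (return borel_intervals (I i)) A) / of_nat n)"
    by (simp add: positive_def)
  show "countably_additive (sets (empirical_measure n I))
      (\<lambda>A. (\<Sum>i = 1..n. emeasure (return borel_intervals (I i)) A) / of_nat n)"
    unfolding countably_additive_def sets_empirical_measure
  proof (intro allI impI)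
    fix B :: "nat \<Rightarrow> (real \<times> real) set"
    assume B: "range B \<subseteq> sets borel_intervals" "disjoint_family B"
    have "(\<Sum>k. (\<Sum>i = 1..n. emeasure (return borel_intervals (I i)) (B k)) / of_nat n)
        = (\<Sum>i = 1..n. \<Sum>k. emeasure (return borel_intervals (I i)) (B k)) / of_nat n"
      by (simp add: suminf_sum del: emeasure_return)
    also have "\<dots> = (\<Sum>i = 1..n. emeasure (return borel_intervals (I i)) (\<Union>k. B k)) / of_nat n"
      using B by (simp add: suminf_emeasure del: emeasure_return)
    finally show "(\<Sum>k. (\<Sum>i = 1..n. emeasure (return borel_intervals (I i)) (B k)) / of_nat n)
        = (\<Sum>i = 1..n. emeasure (return borel_intervals (I i)) (\<Union>k. B k)) / of_nat n" .
  qed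
qed

lemma empirical_measure_prob:
  assumes "n \<ge> 1" and "\<And>i. i \<in> {1..n} \<Longrightarrow> I i \<in> intervals"
  shows "empirical_measure n I \<in> space (prob_algebra borel_intervals)"
proof -
  have sp: "space borel_intervals = intervals"
    by (simp add: borel_intervals_def space_restrict_space)
  have "space (empirical_measure n I) = intervals"
    using sets_eq_imp_space_eq[OF sets_empirical_measure] sp by simp
  moreover have "emeasure (empirical_measure n I) intervals = 1"
  proof -
    have top: "intervals \<in> sets borel_intervals"
      using sets.top[of borel_intervals] by (simp add: sp)
    have "(\<Sum>i = 1..n. emeasure (return borel_intervals (I i)) intervals) = (\<Sum>i = 1..n. 1)"
      using assms(2) by (intro sum.cong) (simp_all add: emeasure_return[OF top])
    then show ?thesis
      using assms(1)
      by (simp add: emeasure_empirical_measure[OF top] ennreal_of_nat_eq_real_of_nat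
          divide_ennreal)
  qed
  ultimately show ?thesis
    by (auto simp: space_prob_algebra sets_empirical_measure intro!: prob_spaceI)
qed

definition converges_weakly ::
    "(nat \<Rightarrow> (real \<times> real) measure) \<Rightarrow> (real \<times> real) measure \<Rightarrow> bool" where
  "converges_weakly M \<mu> \<longleftrightarrow>
     (\<forall>f :: real \<times> real \<Rightarrow> real. continuous_on intervals f \<and> bounded (f ` intervals) \<longrightarrow>
        (\<lambda>n. \<integral>x. f x \<partial>(M n)) \<longlonglongrightarrow> (\<integral>x. f x \<partial>\<mu>))"

end

theory Submission
  imports Defs
begin

text \<open>
  The density of \<open>F\<close> in the interval graph is the probability that a random map from the
  vertices of \<open>F\<close> to \<open>{1..n}\<close> sends edges to pairs of distinct indices whose intervals meet. If the
  word ``distinct'' is dropped, this becomes the integral of \<open>\<Prod> W\<close> against the product of copies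
  of the empirical measure. Dropping it costs at most \<open>1 / n\<close> for each edge, the probability that two
  random indices coincide (\<open>hom_density_interval_graph_bound\<close>). What remains is to pass to the weak
  limit in an integral of the function \<open>\<Prod> W\<close>, which is discontinuous
  (\<open>tendsto_interval_density\<close>).

  For a sum of products of continuous functions of single coordinates, Fubini's theorem turns the
  integral into sums of products of one-dimensional integrals, so the passage to the limit is
  immediate from the definition of weak convergence (\<open>tendsto_integral_separable\<close>).
  Two intervals \<open>[a, b]\<close> and \<open>[a', b']\<close> meet iff
  \<open>a \<le> b'\<close> and \<open>a' \<le> b\<close>. A piecewise linear partition of unity with mesh \<open>1 / m\<close>
  gives a separable approximation of the relation \<open>s \<le> t\<close>, whose error is bounded by a function
  \<open>near m\<close> that is separable too, takes values in \<open>[0, 1]\<close>, and tends to \<open>0\<close> off the diagonal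
  (\<open>le_approx_error\<close>, \<open>near_tendsto_0\<close>).

  Since the error bound is itself separable, its integral against the empirical measures converges,
  as \<open>n \<rightarrow> \<infinity>\<close>, to its integral against \<open>\<mu>\<close>. The latter tends to \<open>0\<close> as \<open>m \<rightarrow> \<infinity>\<close> by
  dominated convergence, because the left end of one random interval almost surely differs from the
  right end of an independent one. This is where the absence of common atoms enters
  (\<open>AE_endpoints_distinct\<close>).

  The graph limit with the densities given by \<open>\<mu>\<close> exists because the interval graphs themselves
  form a sequence with these limiting densities (\<open>converges_to_interval_limit\<close>).
\<close>

section \<open>Sums of products of one-variable functions\<close>

text \<open>
  The smallest class of functions of finitely many intervals that contains the products of continuous
  functions of the coordinates and is closed under sums. An inductive predicate avoids carrying
  index sets and coefficients, and closure under multiplication is proved by induction.\<close>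

inductive separable :: "'i set \<Rightarrow> (('i \<Rightarrow> real \<times> real) \<Rightarrow> real) \<Rightarrow> bool" for V where
  separable_zero: "separable V (\<lambda>_. 0)"
| separable_product:
    "(\<And>i. i \<in> V \<Longrightarrow> continuous_on intervals (f i)) \<Longrightarrow> separable V (\<lambda>x. \<Prod>i\<in>V. f i (x i))"
| separable_add: "separable V \<Phi> \<Longrightarrow> separable V \<Psi> \<Longrightarrow> separable V (\<lambda>x. \<Phi> x + \<Psi> x)"

lemma separable_one: "separable V (\<lambda>_. 1)"
  using separable_product[of V "\<lambda>_ _. 1"] by simp

text \<open>The case of \<open>separable_mult\<close> in which one factor is a single product: multiply coordinatewise.\<close>

lemma separable_mult_product:
  assumes "separable V \<Phi>" and "\<And>i. i \<in> V \<Longrightarrow> continuous_on intervals (f i)"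
  shows "separable V (\<lambda>x. \<Phi> x * (\<Prod>i\<in>V. f i (x i)))"
  using assms(1)
proof induction
  case (separable_product g)
  then show ?case
    using separable.separable_product[of V "\<lambda>i y. g i y * f i y"] assms(2)
    by (simp add: prod.distrib continuous_on_mult)
qed (auto simp: distrib_right intro: separable.intros)

lemma separable_mult:
  assumes "separable V \<Phi>" and "separable V \<Psi>"
  shows "separable V (\<lambda>x. \<Phi> x * \<Psi> x)"
  using assms(2)
proof induction
  case (separable_product f)
  then show ?case by (rule separable_mult_product[OF assms(1)])
qed (auto simp: distrib_left intro: separable.intros)

lemma separable_sum: "(\<And>k. k \<in> K \<Longrightarrow> separable V (\<Phi> k)) \<Longrightarrow> separable V (\<lambda>x. \<Sum>k\<in>K. \<Phi> k x)"
  by (induction K rule: infinite_finite_induct) (auto intro: separable.intros)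

lemma separable_prod: "(\<And>k. k \<in> K \<Longrightarrow> separable V (\<Phi> k)) \<Longrightarrow> separable V (\<lambda>x. \<Prod>k\<in>K. \<Phi> k x)"
  by (induction K rule: infinite_finite_induct) (auto intro: separable_one separable_mult)

lemma separable_coordinate:
  assumes "finite V" and "i \<in> V" and "continuous_on intervals f"
  shows "separable V (\<lambda>x. f (x i))"
proof -
  have "(\<Prod>k\<in>V. (if k = i then f else (\<lambda>_. 1)) (x k)) = f (x i)" for x
    using assms(1,2) prod.delta[OF assms(1), of i "\<lambda>k. f (x k)"]
    by (simp add: if_distrib[of "\<lambda>h. h _"] cong: if_cong)
  then show ?thesis
    using separable_product[of V "\<lambda>k. if k = i then f else (\<lambda>_. 1)"] assms(3) by simp
qed


section \<open>Product measures on tuples of intervals\<close>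

lemma space_borel_intervals: "space borel_intervals = intervals"
  by (simp add: borel_intervals_def space_restrict_space)

lemma compact_intervals: "compact intervals"
proof -
  have "closed {x :: real \<times> real. 0 \<le> fst x \<and> fst x \<le> snd x \<and> snd x \<le> 1}"
    by (intro closed_Collect_conj closed_Collect_le continuous_intros)
  from compact_Int_closed[OF compact_Times[OF compact_Icc compact_Icc] this]
  have "compact ({0..1} \<times> {0..1} \<inter> {x :: real \<times> real. 0 \<le> fst x \<and> fst x \<le> snd x \<and> snd x \<le> 1})" .
  also have "{0..1} \<times> {0..1} \<inter> {x. 0 \<le> fst x \<and> fst x \<le> snd x \<and> snd x \<le> 1} = intervals"
    by (auto simp: intervals_def)
  finally show ?thesis .
qed

lemma borel_intervals_law:
  assumes "\<mu> \<in> space (prob_algebra borel_intervals)"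
  shows "prob_space \<mu>" and "sets \<mu> = sets borel_intervals" and "space \<mu> = intervals"
  using assms sets_eq_imp_space_eq[of \<mu> borel_intervals]
  by (auto simp: space_prob_algebra space_borel_intervals)

lemma borel_measurable_continuous_on_intervals:
  assumes "sets \<mu> = sets borel_intervals" and "continuous_on intervals f"
  shows "f \<in> borel_measurable \<mu>"
  using borel_measurable_continuous_on_restrict[OF assms(2)] assms(1) measurable_cong_sets
  unfolding borel_intervals_def by blast

lemma integrable_continuous_on_intervals:
  fixes f :: "real \<times> real \<Rightarrow> real"
  assumes \<mu>: "\<mu> \<in> space (prob_algebra borel_intervals)" and f: "continuous_on intervals f"
  shows "integrable \<mu> f"
proof -
  interpret prob_space \<mu> using borel_intervals_law(1)[OF \<mu>] .
  obtain B where "\<And>x. x \<in> intervals \<Longrightarrow> norm (f x) \<le> B"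
    using compact_imp_bounded[OF compact_continuous_image[OF f compact_intervals]]
    by (auto simp: bounded_iff)
  then show ?thesis
    using borel_measurable_continuous_on_intervals[OF borel_intervals_law(2)[OF \<mu>] f]
    by (intro integrable_const_bound[of _ B]) (auto simp: borel_intervals_law(3)[OF \<mu>])
qed

lemma product_prob_space_const: "prob_space \<mu> \<Longrightarrow> product_prob_space (\<lambda>_. \<mu>)"
  by (simp add: product_prob_space_def product_prob_space_axioms_def product_sigma_finite_def
      prob_space_imp_sigma_finite)

lemma measurable_coordinate_continuous:
  fixes f :: "real \<times> real \<Rightarrow> real"
  assumes "\<mu> \<in> space (prob_algebra borel_intervals)" and "i \<in> V" and "continuous_on intervals f"
  shows "(\<lambda>x. f (x i)) \<in> borel_measurable (Pi\<^sub>M V (\<lambda>_. \<mu>))"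
  using measurable_compose[OF measurable_component_singleton[OF assms(2)]
      borel_measurable_continuous_on_intervals[OF borel_intervals_law(2)[OF assms(1)] assms(3)]] .

lemma integrable_separable:
  assumes \<mu>: "\<mu> \<in> space (prob_algebra borel_intervals)" and V: "finite V" and "separable V \<Phi>"
  shows "integrable (Pi\<^sub>M V (\<lambda>_. \<mu>)) \<Phi>"
  using assms(3)
proof induction
  case (separable_product f)
  interpret product_prob_space "\<lambda>_. \<mu>"
    using product_prob_space_const borel_intervals_law(1)[OF \<mu>] .
  show ?case
    using product_integrable_prod[OF V, of f] separable_product
      integrable_continuous_on_intervals[OF \<mu>] by blast
qed auto

text \<open>
  By independence of the coordinates, the integral of a product is the product of the
  one-dimensional integrals, to which weak convergence applies: continuous functions on the compact
  set \<open>intervals\<close> are bounded.\<close>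

lemma tendsto_integral_separable:
  assumes \<nu>: "\<And>n. \<nu> n \<in> space (prob_algebra borel_intervals)"
    and \<mu>: "\<mu> \<in> space (prob_algebra borel_intervals)"
    and lim: "converges_weakly \<nu> \<mu>" and V: "finite V" and "separable V \<Phi>"
  shows "(\<lambda>n. \<integral>x. \<Phi> x \<partial>(Pi\<^sub>M V (\<lambda>_. \<nu> n))) \<longlonglongrightarrow> (\<integral>x. \<Phi> x \<partial>(Pi\<^sub>M V (\<lambda>_. \<mu>)))"
  using assms(5)
proof induction
  case (separable_product f)
  have *: "(\<integral>x. (\<Prod>i\<in>V. f i (x i)) \<partial>(Pi\<^sub>M V (\<lambda>_. \<rho>))) = (\<Prod>i\<in>V. \<integral>y. f i y \<partial>\<rho>)"
    if \<rho>: "\<rho> \<in> space (prob_algebra borel_intervals)" for \<rho>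
  proof -
    interpret product_prob_space "\<lambda>_. \<rho>"
      using product_prob_space_const borel_intervals_law(1)[OF \<rho>] .
    show ?thesis
      using product_integral_prod[OF V, of f] separable_product
        integrable_continuous_on_intervals[OF \<rho>] by blast
  qed
  have "(\<lambda>n. \<integral>y. f i y \<partial>\<nu> n) \<longlonglongrightarrow> (\<integral>y. f i y \<partial>\<mu>)" if "i \<in> V" for i
    using lim separable_product[OF that]
      compact_imp_bounded[OF compact_continuous_image[OF _ compact_intervals]]
    unfolding converges_weakly_def by blast
  then show ?case
    unfolding *[OF \<nu>] *[OF \<mu>] by (rule tendsto_prod)
next
  case (separable_add \<Phi> \<Psi>)
  then show ?case
    using integrable_separable[OF \<nu> V] integrable_separable[OF \<mu> V]
    by (simp add: tendsto_add)
qed simp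


section \<open>Approximating the order relation by separable functions\<close>

text \<open>
  The piecewise linear bump of height \<open>1\<close> centred at \<open>i / m\<close> and supported on
  \<open>[(i - 1) / m, (i + 1) / m]\<close>. Writing it as a difference of two consecutive clamped ramps makes
  the sum over \<open>i\<close> telescope.\<close>

definition hat :: "nat \<Rightarrow> nat \<Rightarrow> real \<Rightarrow> real" where
  "hat m i t = max 0 (min 1 (m * t - i + 1)) - max 0 (min 1 (m * t - i))"

lemma hat_nonneg: "0 \<le> hat m i t"
  by (simp add: hat_def)

lemma hat_support: "hat m i t \<noteq> 0 \<Longrightarrow> \<bar>m * t - i\<bar> < 1"
  by (auto simp: hat_def max_def min_def split: if_splits)

lemma sum_hat:
  assumes "t \<in> {0..1}"
  shows "(\<Sum>i\<le>m. hat m i t) = 1"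
proof -
  define c where "c i = max 0 (min 1 (m * t - real i + 1))" for i
  \<comment> \<open>On the unit interval the first ramp is saturated at 1 and the last one is still 0.\<close>
  have "(\<Sum>i\<le>m. hat m i t) = (\<Sum>i\<le>m. c i - c (Suc i))"
    by (simp add: hat_def c_def)
  also have "\<dots> = c 0 - c (Suc m)"
    by (rule sum_telescope)
  also have "real m * t \<le> real m" "0 \<le> real m * t"
    using assms by (auto intro: mult_left_le)
  then have "c 0 - c (Suc m) = 1"
    by (auto simp: c_def max_def min_def)
  finally show ?thesis .
qed

lemma continuous_on_hat: "continuous_on A (hat m i)"
  unfolding hat_def[abs_def] by (intro continuous_intros)

text \<open>
  The discretization of a relation on \<open>[0, 1]\<close> to the grid of mesh \<open>1 / m\<close>, smoothed by the
  partition of unity. It is separable, and at \<open>(s, t)\<close> it only sees the truth of \<open>R\<close> at the grid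
  points adjacent to \<open>(s, t)\<close>.\<close>

definition grid_sum :: "nat \<Rightarrow> (nat \<Rightarrow> nat \<Rightarrow> bool) \<Rightarrow> real \<Rightarrow> real \<Rightarrow> real" where
  "grid_sum m R s t = (\<Sum>(i, j)\<in>{..m} \<times> {..m}. of_bool (R i j) * (hat m i s * hat m j t))"

lemma grid_sum_nonneg: "0 \<le> grid_sum m R s t"
  unfolding grid_sum_def by (auto intro!: sum_nonneg mult_nonneg_nonneg hat_nonneg)

lemma grid_sum_False:
  assumes "\<And>i j. \<bar>m * s - i\<bar> < 1 \<Longrightarrow> \<bar>m * t - j\<bar> < 1 \<Longrightarrow> \<not> R i j"
  shows "grid_sum m R s t = 0"
  unfolding grid_sum_def using assms hat_support by (intro sum.neutral) fastforce

text \<open>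
  The products of bumps form a partition of unity on the square. So upper bounds for \<open>grid_sum\<close>
  follow from lower bounds for the complementary relation.\<close>

lemma grid_sum_not:
  assumes "s \<in> {0..1}" and "t \<in> {0..1}"
  shows "grid_sum m (\<lambda>i j. \<not> R i j) s t = 1 - grid_sum m R s t"
proof -
  have "grid_sum m R s t + grid_sum m (\<lambda>i j. \<not> R i j) s t
      = (\<Sum>(i, j)\<in>{..m} \<times> {..m}. hat m i s * hat m j t)"
    unfolding grid_sum_def sum.distrib[symmetric] by (intro sum.cong) auto
  also have "\<dots> = (\<Sum>i\<le>m. hat m i s) * (\<Sum>j\<le>m. hat m j t)"
    by (simp add: sum_product sum.cartesian_product)
  finally show ?thesis
    using assms by (simp add: sum_hat)
qed

lemma grid_sum_le_1: "s \<in> {0..1} \<Longrightarrow> t \<in> {0..1} \<Longrightarrow> grid_sum m R s t \<le> 1"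
  using grid_sum_not[of s t m R] grid_sum_nonneg[of m "\<lambda>i j. \<not> R i j" s t] by simp

lemma grid_sum_True:
  assumes "s \<in> {0..1}" and "t \<in> {0..1}"
    and "\<And>i j. \<bar>m * s - i\<bar> < 1 \<Longrightarrow> \<bar>m * t - j\<bar> < 1 \<Longrightarrow> R i j"
  shows "grid_sum m R s t = 1"
  using grid_sum_not[OF assms(1,2), of m R] grid_sum_False[of m s t "\<lambda>i j. \<not> R i j"] assms(3)
  by simp

lemma separable_grid_sum:
  assumes "finite V" and "i \<in> V" and "j \<in> V"
    and f: "continuous_on intervals f" and g: "continuous_on intervals g"
  shows "separable V (\<lambda>x. grid_sum m R (f (x i)) (g (x j)))"
proof -
  have *: "separable V (\<lambda>x. hat m k (f (x i)))" "separable V (\<lambda>x. hat m k (g (x j)))" for k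
    using assms by (auto intro!: separable_coordinate[where f = "\<lambda>y. hat m k (f y)"]
        separable_coordinate[where f = "\<lambda>y. hat m k (g y)"]
        continuous_on_compose2[OF continuous_on_hat[of UNIV]])
  have "separable V (\<lambda>x. of_bool (R k l) * (hat m k (f (x i)) * hat m l (g (x j))))" for k l
    using separable_mult[OF *] by (cases "R k l") (auto intro: separable_zero)
  then show ?thesis
    unfolding grid_sum_def by (intro separable_sum) auto
qed

definition le_approx :: "nat \<Rightarrow> real \<Rightarrow> real \<Rightarrow> real" where
  "le_approx m = grid_sum m (\<le>)"

text \<open>
  The width \<open>3\<close> is the least one for which \<open>near m s t = 1\<close> whenever \<open>\<bar>s - t\<bar> < 2 / m\<close>: the grid
  indices adjacent to \<open>s\<close> and \<open>t\<close> then differ by less than \<open>4\<close>.\<close>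

definition near :: "nat \<Rightarrow> real \<Rightarrow> real \<Rightarrow> real" where
  "near m = grid_sum m (\<lambda>i j. i \<le> j + 3 \<and> j \<le> i + 3)"

text \<open>
  If \<open>\<bar>s - t\<bar> \<ge> 2 / m\<close>, all grid indices adjacent to \<open>s\<close> and \<open>t\<close> are ordered as \<open>s\<close> and \<open>t\<close>
  are, and the approximation is exact. Otherwise the bound is \<open>1\<close>.\<close>

lemma le_approx_error:
  assumes s: "s \<in> {0..1}" and t: "t \<in> {0..1}"
  shows "\<bar>of_bool (s \<le> t) - le_approx m s t\<bar> \<le> near m s t"
proof (cases "\<bar>m * s - m * t\<bar> < 2")
  case True
  have "near m s t = 1"
    unfolding near_def using True by (intro grid_sum_True s t) linarith
  moreover have "0 \<le> le_approx m s t" "le_approx m s t \<le> 1"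
    unfolding le_approx_def using grid_sum_nonneg grid_sum_le_1[OF s t] by auto
  ultimately show ?thesis by auto
next
  case far: False
  have "of_bool (s \<le> t) = le_approx m s t"
  proof (cases "s \<le> t")
    case True
    then have "m * s \<le> m * t" by (simp add: mult_left_mono)
    with far True show ?thesis
      unfolding le_approx_def by (subst grid_sum_True[OF s t]) auto
  next
    case False
    then have "m * t \<le> m * s" by (simp add: mult_left_mono)
    with far False show ?thesis
      unfolding le_approx_def by (subst grid_sum_False) auto
  qed
  then show ?thesis
    by (simp add: near_def grid_sum_nonneg)
qed

lemma near_tendsto_0:
  assumes "s \<noteq> t"
  shows "(\<lambda>m. near m s t) \<longlonglongrightarrow> 0"
proof (rule tendsto_eventually)
  obtain N :: nat where N: "5 / \<bar>s - t\<bar> \<le> N"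
    using real_arch_simple by blast
  have "near m s t = 0" if "m \<ge> N" for m
  proof -
    \<comment> \<open>Adjacent grid indices then differ by more than 5 - 2 = 3.\<close>
    have "5 / \<bar>s - t\<bar> \<le> m" using N that by linarith
    then have "5 \<le> m * \<bar>s - t\<bar>"
      using assms by (simp add: divide_simps)
    also have "\<dots> = \<bar>m * s - m * t\<bar>"
      by (simp add: abs_mult flip: right_diff_distrib)
    finally have "5 \<le> \<bar>m * s - m * t\<bar>" .
    then show ?thesis
      unfolding near_def by (intro grid_sum_False) linarith
  qed
  then show "\<forall>\<^sub>F m in sequentially. near m s t = 0"
    by (auto simp: eventually_sequentially)
qed

section \<open>Endpoints of independent intervals\<close>

text \<open>Distinct coordinates are independent; it suffices to compare both measures on rectangles.\<close>

lemma distr_PiM_pair: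
  assumes \<mu>: "prob_space \<mu>" and V: "finite V" and ij: "i \<in> V" "j \<in> V" "i \<noteq> j"
  shows "distr (Pi\<^sub>M V (\<lambda>_. \<mu>)) (\<mu> \<Otimes>\<^sub>M \<mu>) (\<lambda>x. (x i, x j)) = \<mu> \<Otimes>\<^sub>M \<mu>"
proof -
  interpret prob_space \<mu> by fact
  interpret P: product_prob_space "\<lambda>_. \<mu>" V
    using product_prob_space_const[OF \<mu>] .
  have [measurable]: "(\<lambda>x. (x i, x j)) \<in> Pi\<^sub>M V (\<lambda>_. \<mu>) \<rightarrow>\<^sub>M \<mu> \<Otimes>\<^sub>M \<mu>"
    using ij by (intro measurable_Pair measurable_component_singleton)
  have "emeasure \<mu> A * emeasure \<mu> B
      = emeasure (distr (Pi\<^sub>M V (\<lambda>_. \<mu>)) (\<mu> \<Otimes>\<^sub>M \<mu>) (\<lambda>x. (x i, x j))) (A \<times> B)"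
    if A: "A \<in> sets \<mu>" and B: "B \<in> sets \<mu>" for A B
  proof -
    define C where "C k = (if k = i then A else if k = j then B else space \<mu>)" for k
    have "(\<lambda>x. (x i, x j)) -` (A \<times> B) \<inter> space (Pi\<^sub>M V (\<lambda>_. \<mu>)) = Pi\<^sub>E V C"
      using ij sets.sets_into_space[OF A] sets.sets_into_space[OF B]
      by (auto simp: space_PiM PiE_iff C_def split: if_splits) (metis subsetD)
    then have "emeasure (distr (Pi\<^sub>M V (\<lambda>_. \<mu>)) (\<mu> \<Otimes>\<^sub>M \<mu>) (\<lambda>x. (x i, x j))) (A \<times> B)
        = emeasure (Pi\<^sub>M V (\<lambda>_. \<mu>)) (Pi\<^sub>E V C)"
      using A B by (subst emeasure_distr) auto
    also have "\<dots> = (\<Prod>k\<in>V. emeasure \<mu> (C k))"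
      using A B by (intro P.emeasure_PiM V) (simp add: C_def)
    also have "\<dots> = (\<Prod>k\<in>{i, j}. emeasure \<mu> (C k))"
      using V ij by (intro prod.mono_neutral_right) (auto simp: C_def emeasure_space_1)
    finally show ?thesis
      using ij by (simp add: C_def)
  qed
  then show ?thesis
    by (intro pair_measure_eqI[symmetric] sigma_finite_measure_axioms) auto
qed

lemma measurable_endpoints:
  assumes "sets \<mu> = sets borel_intervals"
  shows "fst \<in> \<mu> \<rightarrow>\<^sub>M restrict_space borel {0..1}" and "snd \<in> \<mu> \<rightarrow>\<^sub>M restrict_space borel {0..1}"
proof -
  have "f \<in> \<mu> \<rightarrow>\<^sub>M restrict_space borel {0..1}"
    if "f \<in> borel \<rightarrow>\<^sub>M borel" "f ` intervals \<subseteq> {0..1}" for f :: "real \<times> real \<Rightarrow> real"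
  proof -
    have "f \<in> restrict_space borel intervals \<rightarrow>\<^sub>M restrict_space borel {0..1}"
      using that by (intro measurable_restrict_space3) auto
    then show ?thesis
      using measurable_cong_sets[OF assms refl, of "restrict_space borel {0..1}"]
      unfolding borel_intervals_def by blast
  qed
  note * = this
  show "fst \<in> \<mu> \<rightarrow>\<^sub>M restrict_space borel {0..1}"
    by (rule *) (auto simp: intervals_def intro!: borel_measurable_continuous_onI continuous_intros)
  show "snd \<in> \<mu> \<rightarrow>\<^sub>M restrict_space borel {0..1}"
    by (rule *) (auto simp: intervals_def intro!: borel_measurable_continuous_onI continuous_intros)
qed

text \<open>
  The last assumption covers points outside the space of \<open>N\<close>, which \<open>f\<close> never attains: the marginals
  live on \<open>[0, 1]\<close>, but atoms are sought among all real numbers.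
\<close>

lemma AE_not_atom:
  assumes M: "prob_space M" and f: "f \<in> M \<rightarrow>\<^sub>M N"
    and "measure (distr M N f) {c} = 0" and "{c} \<in> sets N \<or> c \<notin> space N"
  shows "AE x in M. f x \<noteq> c"
proof -
  interpret prob_space M by fact
  interpret D: prob_space "distr M N f" using prob_space_distr[OF f] .
  have "AE y in distr M N f. y \<noteq> c"
    using assms(4)
  proof
    assume "{c} \<in> sets N"
    then have "{c} \<in> null_sets (distr M N f)"
      using assms(3) by (simp add: null_sets_def D.emeasure_eq_measure)
    then show ?thesis
      by (intro AE_I'[of "{c}"]) auto
  next
    assume "c \<notin> space N"
    then show ?thesis by (intro AE_I2) (metis space_distr)
  qed
  then show ?thesis by (rule AE_distrD[OF f])
qed

text \<open>
  Fix the right end \<open>c\<close> of the first interval. The left end of the second one equals \<open>c\<close> with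
  positive probability only if \<open>c\<close> is one of the countably many atoms of the left marginal. None of
  these is an atom of the right marginal, so the first interval almost surely avoids all of them.\<close>

lemma AE_endpoints_distinct:
  assumes \<mu>: "\<mu> \<in> space (prob_algebra borel_intervals)"
    and no_atom: "\<not> (\<exists>c. common_atom \<mu> c)"
  shows "AE z in \<mu> \<Otimes>\<^sub>M \<mu>. snd (fst z) \<noteq> fst (snd z)"
proof -
  note law = borel_intervals_law[OF \<mu>]
  note ends = measurable_endpoints[OF law(2)]
  interpret prob_space \<mu> by (rule law)
  interpret pair_prob_space \<mu> \<mu> ..
  let ?I = "restrict_space borel {0..1} :: real measure"
  have sing: "{c} \<in> sets ?I \<or> c \<notin> space ?I" for c
    by (auto simp: sets_restrict_space_iff space_restrict_space)
  interpret L: prob_space "left_marginal \<mu>"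
    unfolding left_marginal_def by (rule prob_space.prob_space_distr[OF law(1) ends(1)])
  define C where "C = {c. measure (left_marginal \<mu>) {c} \<noteq> 0}"
  have "countable C"
    unfolding C_def by (rule L.countable_support)
  moreover have "AE y in \<mu>. snd y \<noteq> c" if "c \<in> C" for c
  proof (rule AE_not_atom[OF law(1) ends(2) _ sing])
    have "measure (left_marginal \<mu>) {c} > 0"
      using that by (simp add: C_def zero_less_measure_iff)
    then have "\<not> measure (right_marginal \<mu>) {c} > 0"
      using no_atom by (auto simp: common_atom_def)
    then show "measure (distr \<mu> ?I snd) {c} = 0"
      by (simp add: zero_less_measure_iff right_marginal_def)
  qed
  ultimately have "AE y in \<mu>. \<forall>c\<in>C. snd y \<noteq> c"
    by (simp add: AE_ball_countable)
  then have ae: "AE y in \<mu>. AE x in \<mu>. snd y \<noteq> fst x"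
  proof eventually_elim
    case (elim y)
    then have "measure (distr \<mu> ?I fst) {snd y} = 0"
      unfolding C_def left_marginal_def by blast
    then have "AE x in \<mu>. fst x \<noteq> snd y"
      by (rule AE_not_atom[OF law(1) ends(1) _ sing])
    then show "AE x in \<mu>. snd y \<noteq> fst x"
      by eventually_elim simp
  qed
  have [measurable]: "fst \<in> borel_measurable \<mu>" "snd \<in> borel_measurable \<mu>"
    by (intro borel_measurable_continuous_on_intervals law continuous_intros)+
  have "{z \<in> space (\<mu> \<Otimes>\<^sub>M \<mu>). snd (fst z) \<noteq> fst (snd z)} \<in> sets (\<mu> \<Otimes>\<^sub>M \<mu>)"
    by measurable
  then show ?thesis
    by (rule AE_pair_measure) (use ae in simp)
qed

lemma AE_coordinates_distinct:
  assumes \<mu>: "\<mu> \<in> space (prob_algebra borel_intervals)"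
    and no_atom: "\<not> (\<exists>c. common_atom \<mu> c)"
    and V: "finite V" and ij: "i \<in> V" "j \<in> V" "i \<noteq> j"
  shows "AE x in Pi\<^sub>M V (\<lambda>_. \<mu>). fst (x i) \<noteq> snd (x j)"
proof -
  have pair: "(\<lambda>x. (x j, x i)) \<in> Pi\<^sub>M V (\<lambda>_. \<mu>) \<rightarrow>\<^sub>M \<mu> \<Otimes>\<^sub>M \<mu>"
    using ij by (intro measurable_Pair measurable_component_singleton)
  have "AE z in distr (Pi\<^sub>M V (\<lambda>_. \<mu>)) (\<mu> \<Otimes>\<^sub>M \<mu>) (\<lambda>x. (x j, x i)).
      snd (fst z) \<noteq> fst (snd z)"
    unfolding distr_PiM_pair[OF borel_intervals_law(1)[OF \<mu>] V ij(2,1) ij(3)[symmetric]]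
    by (rule AE_endpoints_distinct[OF \<mu> no_atom])
  from AE_distrD[OF pair this] show ?thesis
    by eventually_elim auto
qed

section \<open>Convergence of interval densities\<close>

text \<open>The index set of the product in \<open>interval_density\<close>.\<close>

definition ordered_edges :: "graph \<Rightarrow> (nat \<times> nat) set" where
  "ordered_edges F = {(i, j). i < j \<and> {i, j} \<in> edges F}"

lemma ordered_edgesD:
  assumes "(i, j) \<in> ordered_edges F"
  shows "i \<in> verts F" and "j \<in> verts F" and "i \<noteq> j"
  using assms edgeD(1)[of "{i, j}" F] by (auto simp: ordered_edges_def)

lemma finite_ordered_edges: "finite (ordered_edges F)"
proof (rule finite_subset)
  show "ordered_edges F \<subseteq> verts F \<times> verts F"
    using ordered_edgesD by auto
qed (simp add: finite_verts)

lemma edge_iff_ordered_edge: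
  "{i, j} \<in> edges F \<longleftrightarrow> (i, j) \<in> ordered_edges F \<or> (j, i) \<in> ordered_edges F"
  using edgeD(2)[of "{i, j}" F]
  by (cases i j rule: linorder_cases) (auto simp: ordered_edges_def insert_commute)

text \<open>
  \<open>W\<close> is the product of the indicators of two inequalities between endpoints (see \<open>W_eq\<close>); each is
  replaced by its grid approximation, and \<open>W_error\<close> adds up the two errors.\<close>

definition W_approx :: "nat \<Rightarrow> real \<times> real \<Rightarrow> real \<times> real \<Rightarrow> real" where
  "W_approx m I J = le_approx m (fst I) (snd J) * le_approx m (fst J) (snd I)"

definition W_error :: "nat \<Rightarrow> real \<times> real \<Rightarrow> real \<times> real \<Rightarrow> real" where
  "W_error m I J = near m (fst I) (snd J) + near m (fst J) (snd I)"

lemma W_eq: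
  assumes "I \<in> intervals" and "J \<in> intervals"
  shows "W I J = of_bool (fst I \<le> snd J) * of_bool (fst J \<le> snd I)"
proof -
  have "{fst I..snd I} \<inter> {fst J..snd J} = {max (fst I) (fst J)..min (snd I) (snd J)}"
    by auto
  then show ?thesis
    using assms by (auto simp: W_def intervals_def)
qed

lemma intervals_endpoints:
  assumes "I \<in> intervals"
  shows "fst I \<in> {0..1}" and "snd I \<in> {0..1}"
  using assms by (auto simp: intervals_def)

lemma abs_W_approx_le_1:
  assumes "I \<in> intervals" and "J \<in> intervals"
  shows "\<bar>W_approx m I J\<bar> \<le> 1"
  using assms[THEN intervals_endpoints(1)] assms[THEN intervals_endpoints(2)]
  by (auto simp: W_approx_def le_approx_def grid_sum_nonneg abs_mult
      intro!: mult_le_one grid_sum_le_1)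

lemma W_approx_error:
  assumes "I \<in> intervals" and "J \<in> intervals"
  shows "\<bar>W I J - W_approx m I J\<bar> \<le> W_error m I J"
proof -
  note ends = assms[THEN intervals_endpoints(1)] assms[THEN intervals_endpoints(2)]
  define p q p' q' :: real where "p = of_bool (fst I \<le> snd J)" and "q = of_bool (fst J \<le> snd I)"
    and "p' = le_approx m (fst I) (snd J)" and "q' = le_approx m (fst J) (snd I)"
  \<comment> \<open>Exchange one factor at a time; the factor that is kept has absolute value at most 1.\<close>
  have "\<bar>p * q - p' * q'\<bar> = \<bar>(p - p') * q + p' * (q - q')\<bar>"
    by (simp add: algebra_simps)
  also have "\<dots> \<le> \<bar>p - p'\<bar> * \<bar>q\<bar> + \<bar>p'\<bar> * \<bar>q - q'\<bar>"
    using abs_triangle_ineq by (metis abs_mult)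
  also have "\<dots> \<le> \<bar>p - p'\<bar> + \<bar>q - q'\<bar>"
    using ends grid_sum_nonneg grid_sum_le_1
    by (intro add_mono mult_left_le mult_left_le_one_le) (auto simp: p'_def q_def le_approx_def)
  also have "\<dots> \<le> W_error m I J"
    unfolding W_error_def p_def p'_def q_def q'_def
    using ends by (intro add_mono le_approx_error)
  finally show ?thesis
    by (simp add: W_eq[OF assms] W_approx_def p_def q_def p'_def q'_def)
qed

lemma interval_density_alt:
  "interval_density F \<mu> =
    (\<integral>x. (\<Prod>(i, j)\<in>ordered_edges F. W (x i) (x j)) \<partial>(Pi\<^sub>M (verts F) (\<lambda>_. \<mu>)))"
  by (simp add: interval_density_def ordered_edges_def)

lemma separable_W_approx:
  "separable (verts F) (\<lambda>x. \<Prod>(i, j)\<in>ordered_edges F. W_approx m (x i) (x j))"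
  unfolding W_approx_def le_approx_def split_def
  by (intro separable_prod separable_mult separable_grid_sum)
     (auto dest: ordered_edgesD intro!: finite_verts continuous_intros)

lemma separable_W_error:
  "separable (verts F) (\<lambda>x. \<Sum>(i, j)\<in>ordered_edges F. W_error m (x i) (x j))"
  unfolding W_error_def near_def split_def
  by (intro separable_sum separable_add separable_grid_sum)
     (auto dest: ordered_edgesD intro!: finite_verts continuous_intros)

lemma measurable_W_product:
  assumes \<mu>: "\<mu> \<in> space (prob_algebra borel_intervals)"
  shows "(\<lambda>x. \<Prod>(i, j)\<in>ordered_edges F. W (x i) (x j)) \<in> borel_measurable (Pi\<^sub>M (verts F) (\<lambda>_. \<mu>))"
proof -
  let ?P = "Pi\<^sub>M (verts F) (\<lambda>_. \<mu>)"
  have "(\<lambda>x. W (x i) (x j)) \<in> borel_measurable ?P" if e: "(i, j) \<in> ordered_edges F" for i j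
  proof -
    note ij = ordered_edgesD(1,2)[OF e]
    have meas: "(\<lambda>x. fst (x i)) \<in> borel_measurable ?P" "(\<lambda>x. snd (x i)) \<in> borel_measurable ?P"
      "(\<lambda>x. fst (x j)) \<in> borel_measurable ?P" "(\<lambda>x. snd (x j)) \<in> borel_measurable ?P"
      using ij by (auto intro!: measurable_coordinate_continuous[OF \<mu>] continuous_intros)
    have "(\<lambda>x. of_bool (f x \<le> g x) :: real) \<in> borel_measurable ?P"
      if "f \<in> borel_measurable ?P" "g \<in> borel_measurable ?P" for f g :: "_ \<Rightarrow> real"
      unfolding of_bool_def using that by measurable
    then have "(\<lambda>x. of_bool (fst (x i) \<le> snd (x j)) * of_bool (fst (x j) \<le> snd (x i)) :: real)
        \<in> borel_measurable ?P"
      using meas by (intro borel_measurable_times)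
    then show ?thesis
      using ij by (subst measurable_cong[OF W_eq])
        (auto simp: space_PiM borel_intervals_law(3)[OF \<mu>])
  qed
  then show ?thesis
    by (auto intro!: borel_measurable_prod simp: split_def)
qed

text \<open>
  A product of numbers in \<open>[-1, 1]\<close> changes by at most the sum of the changes of its factors
  (\<open>norm_prod_diff\<close>), so the errors of the edges add up. The bound holds for every \<open>\<mu>\<close> and is an
  integral of a separable function, which allows it to be controlled along a weakly convergent
  sequence.\<close>

lemma interval_density_approx:
  assumes \<mu>: "\<mu> \<in> space (prob_algebra borel_intervals)"
  shows "\<bar>interval_density F \<mu>
      - (\<integral>x. (\<Prod>(i, j)\<in>ordered_edges F. W_approx m (x i) (x j)) \<partial>(Pi\<^sub>M (verts F) (\<lambda>_. \<mu>)))\<bar>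
    \<le> (\<integral>x. (\<Sum>(i, j)\<in>ordered_edges F. W_error m (x i) (x j)) \<partial>(Pi\<^sub>M (verts F) (\<lambda>_. \<mu>)))"
proof -
  let ?P = "Pi\<^sub>M (verts F) (\<lambda>_. \<mu>)" and ?E = "ordered_edges F"
  interpret prob_space \<mu> by (rule borel_intervals_law[OF \<mu>])
  interpret P: product_prob_space "\<lambda>_. \<mu>" "verts F"
    by (rule product_prob_space_const) (rule prob_space_axioms)
  have x: "x (fst e) \<in> intervals" "x (snd e) \<in> intervals" if "x \<in> space ?P" "e \<in> ?E" for x e
    using that ordered_edgesD(1,2)[of "fst e" "snd e" F]
    by (auto simp: space_PiM borel_intervals_law(3)[OF \<mu>])
  have "\<bar>\<Prod>(i, j)\<in>?E. W (x i) (x j)\<bar> \<le> 1" for x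
    by (auto simp: abs_prod W_def intro!: prod_le_1)
  then have W: "integrable ?P (\<lambda>x. \<Prod>(i, j)\<in>?E. W (x i) (x j))"
    by (intro P.integrable_const_bound[of _ 1] measurable_W_product \<mu>) auto
  have K: "integrable ?P (\<lambda>x. \<Prod>(i, j)\<in>?E. W_approx m (x i) (x j))"
    by (rule integrable_separable[OF \<mu> finite_verts separable_W_approx])
  have D: "integrable ?P (\<lambda>x. \<Sum>(i, j)\<in>?E. W_error m (x i) (x j))"
    by (rule integrable_separable[OF \<mu> finite_verts separable_W_error])
  have "\<bar>(\<Prod>(i, j)\<in>?E. W (x i) (x j)) - (\<Prod>(i, j)\<in>?E. W_approx m (x i) (x j))\<bar>
      \<le> (\<Sum>(i, j)\<in>?E. W_error m (x i) (x j))" if "x \<in> space ?P" for x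
  proof -
    have "\<bar>(\<Prod>e\<in>?E. W (x (fst e)) (x (snd e))) - (\<Prod>e\<in>?E. W_approx m (x (fst e)) (x (snd e)))\<bar>
      \<le> (\<Sum>e\<in>?E. \<bar>W (x (fst e)) (x (snd e)) - W_approx m (x (fst e)) (x (snd e))\<bar>)"
      by (intro norm_prod_diff[where 'a = real, unfolded real_norm_def])
         (simp_all add: W_def abs_W_approx_le_1 x[OF that])
    also have "\<dots> \<le> (\<Sum>e\<in>?E. W_error m (x (fst e)) (x (snd e)))"
      by (intro sum_mono W_approx_error x[OF that])
    finally show ?thesis by (simp add: split_def)
  qed
  then have "(\<integral>x. \<bar>(\<Prod>(i, j)\<in>?E. W (x i) (x j)) - (\<Prod>(i, j)\<in>?E. W_approx m (x i) (x j))\<bar> \<partial>?P)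
      \<le> (\<integral>x. (\<Sum>(i, j)\<in>?E. W_error m (x i) (x j)) \<partial>?P)"
    using W K D by (intro integral_mono) auto
  then show ?thesis
    unfolding interval_density_alt
    using integral_abs_bound[of ?P "\<lambda>x. (\<Prod>(i, j)\<in>?E. W (x i) (x j)) -
        (\<Prod>(i, j)\<in>?E. W_approx m (x i) (x j))"] W K
    by simp
qed

text \<open>
  For every edge both error terms vanish in the limit off the diagonal, hence almost everywhere. The
  bound \<open>near m \<le> 1\<close> gives a constant dominating function, since each edge has two error terms.\<close>

lemma integral_W_error_tendsto_0:
  assumes \<mu>: "\<mu> \<in> space (prob_algebra borel_intervals)"
    and no_atom: "\<not> (\<exists>c. common_atom \<mu> c)"
  shows "(\<lambda>m. \<integral>x. (\<Sum>(i, j)\<in>ordered_edges F. W_error m (x i) (x j)) \<partial>(Pi\<^sub>M (verts F) (\<lambda>_. \<mu>)))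
    \<longlonglongrightarrow> 0"
proof -
  let ?P = "Pi\<^sub>M (verts F) (\<lambda>_. \<mu>)" and ?E = "ordered_edges F"
  interpret prob_space \<mu> by (rule borel_intervals_law[OF \<mu>])
  interpret P: product_prob_space "\<lambda>_. \<mu>" "verts F"
    by (rule product_prob_space_const) (rule prob_space_axioms)
  have "(\<lambda>m. \<integral>x. (\<Sum>(i, j)\<in>?E. W_error m (x i) (x j)) \<partial>?P) \<longlonglongrightarrow> (\<integral>x. 0 \<partial>?P)"
  proof (rule integral_dominated_convergence[where w = "\<lambda>_. 2 * card ?E"])
    have "AE x in ?P. \<forall>(i, j)\<in>?E. fst (x i) \<noteq> snd (x j) \<and> fst (x j) \<noteq> snd (x i)"
      unfolding split_def
      by (intro AE_finite_allI finite_ordered_edges AE_conjI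
          AE_coordinates_distinct[OF \<mu> no_atom finite_verts])
        (auto dest: ordered_edgesD)
    then show "AE x in ?P. (\<lambda>m. \<Sum>(i, j)\<in>?E. W_error m (x i) (x j)) \<longlonglongrightarrow> 0"
      unfolding W_error_def split_def
      by eventually_elim (intro tendsto_null_sum tendsto_add_zero near_tendsto_0, auto)
    show "AE x in ?P. norm (\<Sum>(i, j)\<in>?E. W_error m (x i) (x j)) \<le> 2 * card ?E" for m
    proof (rule AE_I2)
      fix x assume x: "x \<in> space ?P"
      have "0 \<le> W_error m (x i) (x j) \<and> W_error m (x i) (x j) \<le> 2" if e: "(i, j) \<in> ?E" for i j
      proof -
        have "x i \<in> intervals" "x j \<in> intervals"
          using x ordered_edgesD(1,2)[OF e] by (auto simp: space_PiM borel_intervals_law(3)[OF \<mu>])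
        note ends = this[THEN intervals_endpoints(1)] this[THEN intervals_endpoints(2)]
        have "0 \<le> near m (fst I) (snd J)" for I J :: "real \<times> real"
          unfolding near_def by (rule grid_sum_nonneg)
        moreover have "near m (fst (x i)) (snd (x j)) \<le> 1" "near m (fst (x j)) (snd (x i)) \<le> 1"
          unfolding near_def using ends by (auto intro: grid_sum_le_1)
        ultimately show ?thesis
          by (simp add: W_error_def add_mono[of _ 1 _ 1, simplified])
      qed
      then have "\<bar>\<Sum>(i, j)\<in>?E. W_error m (x i) (x j)\<bar> \<le> (\<Sum>(i, j)\<in>?E. 2)"
        unfolding split_def by (intro order.trans[OF sum_abs] sum_mono) fastforce
      then show "norm (\<Sum>(i, j)\<in>?E. W_error m (x i) (x j)) \<le> 2 * card ?E"
        by (simp add: split_def)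
    qed
  qed (use borel_measurable_integrable[OF integrable_separable[OF \<mu> finite_verts separable_W_error]]
       in auto)
  then show ?thesis by simp
qed

text \<open>
  A three-term estimate. For fixed \<open>m\<close>, the approximated density and its error bound both converge
  as \<open>n \<rightarrow> \<infinity>\<close>; the limiting error bound is small once \<open>m\<close> is large.\<close>

proposition tendsto_interval_density:
  assumes \<nu>: "\<And>n. \<nu> n \<in> space (prob_algebra borel_intervals)"
    and \<mu>: "\<mu> \<in> space (prob_algebra borel_intervals)"
    and lim: "converges_weakly \<nu> \<mu>" and no_atom: "\<not> (\<exists>c. common_atom \<mu> c)"
  shows "(\<lambda>n. interval_density F (\<nu> n)) \<longlonglongrightarrow> interval_density F \<mu>"
proof (rule LIMSEQ_I)
  fix \<epsilon> :: real assume "\<epsilon> > 0"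
  define K where "K m \<rho> = (\<integral>x. (\<Prod>(i, j)\<in>ordered_edges F. W_approx m (x i) (x j))
    \<partial>(Pi\<^sub>M (verts F) (\<lambda>_. \<rho>)))" for m \<rho>
  define D where "D m \<rho> = (\<integral>x. (\<Sum>(i, j)\<in>ordered_edges F. W_error m (x i) (x j))
    \<partial>(Pi\<^sub>M (verts F) (\<lambda>_. \<rho>)))" for m \<rho>
  have approx: "\<bar>interval_density F \<rho> - K m \<rho>\<bar> \<le> D m \<rho>"
    if "\<rho> \<in> space (prob_algebra borel_intervals)" for m \<rho>
    unfolding K_def D_def by (rule interval_density_approx[OF that])
  have "(\<lambda>m. D m \<mu>) \<longlonglongrightarrow> 0"
    unfolding D_def by (rule integral_W_error_tendsto_0[OF \<mu> no_atom])
  \<comment> \<open>Three terms below \<open>\<epsilon> / 4\<close> are compared: the errors under \<open>\<mu>\<close> and under \<open>\<nu> n\<close>,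
    and the distance of the approximations.\<close>
  then have "\<forall>\<^sub>F m in sequentially. D m \<mu> < \<epsilon> / 4"
    by (rule order_tendstoD(2)) (use \<open>\<epsilon> > 0\<close> in simp)
  then obtain m where m: "D m \<mu> < \<epsilon> / 4"
    by (auto simp: eventually_sequentially)
  have "(\<lambda>n. K m (\<nu> n)) \<longlonglongrightarrow> K m \<mu>" "(\<lambda>n. D m (\<nu> n)) \<longlonglongrightarrow> D m \<mu>"
    unfolding K_def D_def
    by (intro tendsto_integral_separable[OF \<nu> \<mu> lim finite_verts]
        separable_W_approx separable_W_error)+
  then have "\<forall>\<^sub>F n in sequentially. \<bar>K m (\<nu> n) - K m \<mu>\<bar> < \<epsilon> / 4 \<and> D m (\<nu> n) < \<epsilon> / 4"
    using m \<open>\<epsilon> > 0\<close> tendstoD[of "\<lambda>n. K m (\<nu> n)" "K m \<mu>" sequentially "\<epsilon> / 4"]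
    by (auto simp: dist_real_def intro!: eventually_conj order_tendstoD(2))
  then have "\<forall>\<^sub>F n in sequentially. norm (interval_density F (\<nu> n) - interval_density F \<mu>) < \<epsilon>"
  proof eventually_elim
    case (elim n)
    then show ?case
      using approx[OF \<nu>[of n], of m] approx[OF \<mu>, of m] m unfolding real_norm_def by linarith
  qed
  then show "\<exists>N. \<forall>n\<ge>N. norm (interval_density F (\<nu> n) - interval_density F \<mu>) < \<epsilon>"
    by (simp add: eventually_sequentially)
qed

section \<open>Densities of the empirical measure and of the interval graph\<close>

lemma measurable_interval_family:
  assumes "\<And>i. i \<in> A \<Longrightarrow> I i \<in> intervals"
  shows "I \<in> uniform_count_measure A \<rightarrow>\<^sub>M borel_intervals"
  using assms by (auto simp: measurable_def space_uniform_count_measure sets_uniform_count_measure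
      space_borel_intervals)

text \<open>A sample from the empirical measure is the interval with a uniformly chosen index.\<close>

lemma empirical_measure_distr:
  assumes n: "n \<ge> 1" and I: "\<And>i. i \<in> {1..n} \<Longrightarrow> I i \<in> intervals"
  shows "empirical_measure n I = distr (uniform_count_measure {1..n}) borel_intervals I"
proof (rule measure_eqI)
  fix A assume "A \<in> sets (empirical_measure n I)"
  then have A: "A \<in> sets borel_intervals"
    by (simp add: sets_empirical_measure)
  have I_meas: "I \<in> uniform_count_measure {1..n} \<rightarrow>\<^sub>M borel_intervals"
    by (rule measurable_interval_family[OF I])
  have "emeasure (empirical_measure n I) A = (\<Sum>i = 1..n. indicator A (I i)) / of_nat n"
    by (simp add: emeasure_empirical_measure A)
  also have "(\<Sum>i = 1..n. indicator A (I i) :: ennreal) = of_nat (card (I -` A \<inter> {1..n}))"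
    by (simp add: indicator_def sum.If_cases Int_def conj_commute vimage_def)
  also have "\<dots> / of_nat n = ennreal (card (I -` A \<inter> {1..n}) / n)"
    using n by (simp add: ennreal_of_nat_eq_real_of_nat divide_ennreal)
  also have "\<dots> = emeasure (distr (uniform_count_measure {1..n}) borel_intervals I) A"
    by (subst emeasure_distr[OF I_meas A])
       (simp add: space_uniform_count_measure emeasure_uniform_count_measure)
  finally show "emeasure (empirical_measure n I) A
      = emeasure (distr (uniform_count_measure {1..n}) borel_intervals I) A" .
qed (simp add: sets_empirical_measure)

text \<open>
  Choosing a map uniformly at random is the same as choosing its values independently and uniformly:
  on boxes both measures are quotients of products of cardinalities.\<close>

lemma PiM_uniform_count_measure:
  assumes V: "finite V" and A: "finite A" "A \<noteq> {}"
  shows "Pi\<^sub>M V (\<lambda>_. uniform_count_measure A) = uniform_count_measure (V \<rightarrow>\<^sub>E A)"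
proof -
  interpret product_prob_space "\<lambda>_. uniform_count_measure A"
    by (rule product_prob_space_const[OF prob_space_uniform_count_measure[OF A]])
  have fin: "finite (V \<rightarrow>\<^sub>E A)"
    using V A by (intro finite_PiE)
  have "sets (Pi\<^sub>M V (\<lambda>_. uniform_count_measure A)) = sets (Pi\<^sub>M V (\<lambda>_. count_space A))"
    by (intro sets_PiM_cong) (simp_all add: sets_uniform_count_measure)
  also have "\<dots> = Pow (V \<rightarrow>\<^sub>E A)"
    using V A by (simp add: count_space_PiM_finite countable_finite)
  finally have sets: "sets (uniform_count_measure (V \<rightarrow>\<^sub>E A))
      = sets (Pi\<^sub>M V (\<lambda>_. uniform_count_measure A))"
    by (simp add: sets_uniform_count_measure)
  show ?thesis
  proof (rule PiM_eqI[OF V sets, symmetric])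
    fix B assume "\<And>i. i \<in> V \<Longrightarrow> B i \<in> sets (uniform_count_measure A)"
    then have B: "\<And>i. i \<in> V \<Longrightarrow> B i \<subseteq> A"
      by (simp add: sets_uniform_count_measure)
    then have "Pi\<^sub>E V B \<subseteq> V \<rightarrow>\<^sub>E A"
      by (intro PiE_mono)
    then have "emeasure (uniform_count_measure (V \<rightarrow>\<^sub>E A)) (Pi\<^sub>E V B)
        = ennreal ((\<Prod>i\<in>V. card (B i)) / (\<Prod>i\<in>V. card A))"
      using fin V by (simp add: emeasure_uniform_count_measure card_PiE)
    also have "\<dots> = ennreal (\<Prod>i\<in>V. card (B i) / card A)"
      by (simp add: prod_dividef)
    also have "\<dots> = (\<Prod>i\<in>V. emeasure (uniform_count_measure A) (B i))"
      using B A by (simp add: emeasure_uniform_count_measure prod_ennreal)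
    finally show "emeasure (uniform_count_measure (V \<rightarrow>\<^sub>E A)) (Pi\<^sub>E V B)
        = (\<Prod>i\<in>V. emeasure (uniform_count_measure A) (B i))" .
  qed
qed

text \<open>
  The maps counted by the density of the empirical measure. They differ from homomorphisms into the
  interval graph in that adjacent vertices may receive the same index, since every interval meets
  itself whereas a simple graph has no loops.\<close>

definition overlap_maps :: "graph \<Rightarrow> nat \<Rightarrow> (nat \<Rightarrow> real \<times> real) \<Rightarrow> (nat \<Rightarrow> nat) set" where
  "overlap_maps F n I = {\<phi> \<in> verts F \<rightarrow>\<^sub>E {1..n}. \<forall>(i, j)\<in>ordered_edges F. W (I (\<phi> i)) (I (\<phi> j)) = 1}"

text \<open>
  The product of copies of the empirical measure is the image of the uniform distribution on maps
  \<open>verts F \<rightarrow> {1..n}\<close>, and on each map the product of the values of \<open>W\<close> is \<open>0\<close> or \<open>1\<close>.\<close>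

lemma interval_density_empirical_measure:
  assumes n: "n \<ge> 1" and I: "\<And>i. i \<in> {1..n} \<Longrightarrow> I i \<in> intervals"
  shows "interval_density F (empirical_measure n I)
    = card (overlap_maps F n I) / card (verts F \<rightarrow>\<^sub>E {1..n})"
proof -
  let ?V = "verts F" and ?E = "ordered_edges F" and ?U = "uniform_count_measure {1..n}"
  have \<mu>: "empirical_measure n I \<in> space (prob_algebra borel_intervals)"
    by (rule empirical_measure_prob[OF assms])
  have ne: "{1..n} \<noteq> {}" using n by simp
  have U: "prob_space ?U"
    by (rule prob_space_uniform_count_measure) (use ne in auto)
  have I_meas: "I \<in> ?U \<rightarrow>\<^sub>M borel_intervals"
    by (rule measurable_interval_family[OF I])
  have E: "empirical_measure n I = distr ?U borel_intervals I"
    by (rule empirical_measure_distr[OF assms])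
  have sets_E: "sets borel_intervals = sets (empirical_measure n I)"
    by (simp add: sets_empirical_measure)
  have I_meas': "I \<in> ?U \<rightarrow>\<^sub>M empirical_measure n I"
    using I_meas measurable_cong_sets[OF refl sets_E] by blast
  have E': "distr ?U (empirical_measure n I) I = empirical_measure n I"
    unfolding E by (rule distr_cong) auto
  have P: "Pi\<^sub>M ?V (\<lambda>_. empirical_measure n I)
      = distr (Pi\<^sub>M ?V (\<lambda>_. ?U)) (Pi\<^sub>M ?V (\<lambda>_. empirical_measure n I)) (compose ?V I)"
    using distr_PiM_finite_prob_space'[OF finite_verts, of F "\<lambda>_. ?U" "\<lambda>_. empirical_measure n I" I]
      U borel_intervals_law(1)[OF \<mu>] I_meas' E' by simp
  have "compose ?V I \<in> Pi\<^sub>M ?V (\<lambda>_. ?U) \<rightarrow>\<^sub>M Pi\<^sub>M ?V (\<lambda>_. empirical_measure n I)"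
    unfolding compose_def
  proof (rule measurable_restrict)
    fix i assume "i \<in> ?V"
    then have "(\<lambda>\<phi>. \<phi> i) \<in> Pi\<^sub>M ?V (\<lambda>_. ?U) \<rightarrow>\<^sub>M ?U"
      by (rule measurable_component_singleton)
    then show "(\<lambda>\<phi>. I (\<phi> i)) \<in> Pi\<^sub>M ?V (\<lambda>_. ?U) \<rightarrow>\<^sub>M empirical_measure n I"
      by (rule measurable_compose) (rule I_meas')
  qed
  then have "interval_density F (empirical_measure n I)
      = (\<integral>\<phi>. (\<Prod>(i, j)\<in>?E. W (compose ?V I \<phi> i) (compose ?V I \<phi> j)) \<partial>(Pi\<^sub>M ?V (\<lambda>_. ?U)))"
    unfolding interval_density_alt
    by (subst P) (rule integral_distr[OF _ measurable_W_product[OF \<mu>]])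
  also have "\<dots> = (\<integral>\<phi>. (\<Prod>(i, j)\<in>?E. W (I (\<phi> i)) (I (\<phi> j))) \<partial>(Pi\<^sub>M ?V (\<lambda>_. ?U)))"
    by (intro Bochner_Integration.integral_cong prod.cong)
       (auto simp: compose_def dest: ordered_edgesD)
  also have "\<dots> = (\<Sum>\<phi>\<in>?V \<rightarrow>\<^sub>E {1..n}. \<Prod>(i, j)\<in>?E. W (I (\<phi> i)) (I (\<phi> j)))
      / card (?V \<rightarrow>\<^sub>E {1..n})"
    using ne by (simp add: PiM_uniform_count_measure finite_verts integral_uniform_count_measure
        finite_PiE)
  also have "(\<Sum>\<phi>\<in>?V \<rightarrow>\<^sub>E {1..n}. \<Prod>(i, j)\<in>?E. W (I (\<phi> i)) (I (\<phi> j)))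
      = (\<Sum>\<phi>\<in>?V \<rightarrow>\<^sub>E {1..n}. of_bool (\<forall>(i, j)\<in>?E. W (I (\<phi> i)) (I (\<phi> j)) = 1))"
  proof (intro sum.cong refl)
    fix \<phi>
    have W01: "W J K = 0 \<or> W J K = 1" for J K
      by (simp add: W_def)
    show "(\<Prod>(i, j)\<in>?E. W (I (\<phi> i)) (I (\<phi> j))) = of_bool (\<forall>(i, j)\<in>?E. W (I (\<phi> i)) (I (\<phi> j)) = 1)"
    proof (cases "\<forall>(i, j)\<in>?E. W (I (\<phi> i)) (I (\<phi> j)) = 1")
      case True
      then show ?thesis by (auto intro!: prod.neutral)
    next
      case False
      then have "\<exists>e\<in>?E. (case e of (i, j) \<Rightarrow> W (I (\<phi> i)) (I (\<phi> j))) = 0"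
        using W01 by fastforce
      with False show ?thesis
        by (simp add: prod_zero finite_ordered_edges)
    qed
  qed
  also have "\<dots> = card (overlap_maps F n I)"
    by (simp add: overlap_maps_def finite_PiE finite_verts of_bool_def sum.If_cases Int_def)
  finally show ?thesis .
qed

text \<open>A map with \<open>\<phi> i = \<phi> j\<close> is determined by its restriction to the complement of \<open>j\<close>.\<close>

lemma card_PiE_coincidence:
  assumes V: "finite V" and A: "finite A" and ij: "i \<in> V" "j \<in> V" "i \<noteq> j"
  shows "card {\<phi> \<in> V \<rightarrow>\<^sub>E A. \<phi> i = \<phi> j} * card A \<le> card (V \<rightarrow>\<^sub>E A)"
proof -
  have "inj_on (\<lambda>\<phi>. restrict \<phi> (V - {j})) {\<phi> \<in> V \<rightarrow>\<^sub>E A. \<phi> i = \<phi> j}"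
  proof (rule inj_onI, clarify)
    fix \<phi> \<psi> assume \<phi>: "\<phi> \<in> V \<rightarrow>\<^sub>E A" "\<phi> i = \<phi> j" and \<psi>: "\<psi> \<in> V \<rightarrow>\<^sub>E A" "\<psi> i = \<psi> j"
      and eq: "restrict \<phi> (V - {j}) = restrict \<psi> (V - {j})"
    have off: "\<phi> k = \<psi> k" if "k \<in> V" "k \<noteq> j" for k
      using fun_cong[OF eq, of k] that by simp
    then have "\<phi> k = \<psi> k" if "k \<in> V" for k
      using \<phi>(2) \<psi>(2) ij that by metis
    then show "\<phi> = \<psi>"
      using PiE_ext[OF \<phi>(1) \<psi>(1)] by blast
  qed
  moreover have "(\<lambda>\<phi>. restrict \<phi> (V - {j})) ` {\<phi> \<in> V \<rightarrow>\<^sub>E A. \<phi> i = \<phi> j} \<subseteq> (V - {j}) \<rightarrow>\<^sub>E A"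
    by (rule image_subsetI) (auto simp: restrict_PiE_iff PiE_mem simp del: PiE_iff)
  ultimately have "card {\<phi> \<in> V \<rightarrow>\<^sub>E A. \<phi> i = \<phi> j} \<le> card ((V - {j}) \<rightarrow>\<^sub>E A)"
    using V A by (intro card_inj_on_le finite_PiE) auto
  then have "card {\<phi> \<in> V \<rightarrow>\<^sub>E A. \<phi> i = \<phi> j} * card A \<le> card A ^ (card V - 1) * card A"
    using V ij by (simp add: card_PiE)
  also have "\<dots> = card A ^ card V"
    using V ij card_gt_0_iff[of V] by (metis Suc_diff_1 empty_iff power_Suc2)
  finally show ?thesis
    using V by (simp add: card_PiE)
qed

lemma edge_interval_graph_iff:
  assumes "k \<in> {1..n}" and "l \<in> {1..n}"
  shows "{k, l} \<in> edges (interval_graph n J) \<longleftrightarrow> k \<noteq> l \<and> J k \<inter> J l \<noteq> {}"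
  using assms unfolding edges_interval_graph doubleton_eq_iff mem_Collect_eq by blast

lemma homs_interval_graph:
  "homs F (interval_graph n (\<lambda>i. {fst (I i)..snd (I i)}))
    = {\<phi> \<in> overlap_maps F n I. \<forall>(i, j)\<in>ordered_edges F. \<phi> i \<noteq> \<phi> j}"
proof -
  let ?G = "interval_graph n (\<lambda>i. {fst (I i)..snd (I i)})"
  have edge: "{k, l} \<in> edges ?G \<longleftrightarrow> k \<noteq> l \<and> W (I k) (I l) = 1" if "k \<in> {1..n}" "l \<in> {1..n}" for k l
    unfolding edge_interval_graph_iff[OF that] W_def by simp
  have "(\<forall>i j. {i, j} \<in> edges F \<longrightarrow> {\<phi> i, \<phi> j} \<in> edges ?G) \<longleftrightarrow>
      (\<forall>(i, j)\<in>ordered_edges F. \<phi> i \<noteq> \<phi> j \<and> W (I (\<phi> i)) (I (\<phi> j)) = 1)"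
    if \<phi>: "\<phi> \<in> verts F \<rightarrow>\<^sub>E {1..n}" for \<phi>
  proof -
    have "(\<forall>i j. {i, j} \<in> edges F \<longrightarrow> {\<phi> i, \<phi> j} \<in> edges ?G) \<longleftrightarrow>
        (\<forall>(i, j)\<in>ordered_edges F. {\<phi> i, \<phi> j} \<in> edges ?G)"
      by (auto simp: edge_iff_ordered_edge insert_commute)
    also have "\<dots> \<longleftrightarrow> (\<forall>(i, j)\<in>ordered_edges F. \<phi> i \<noteq> \<phi> j \<and> W (I (\<phi> i)) (I (\<phi> j)) = 1)"
    proof (intro ball_cong refl, clarify)
      fix i j assume "(i, j) \<in> ordered_edges F"
      then have "\<phi> i \<in> {1..n}" "\<phi> j \<in> {1..n}"
        using PiE_mem[OF \<phi>] ordered_edgesD by blast+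
      then show "{\<phi> i, \<phi> j} \<in> edges ?G \<longleftrightarrow> \<phi> i \<noteq> \<phi> j \<and> W (I (\<phi> i)) (I (\<phi> j)) = 1"
        by (rule edge)
    qed
    finally show ?thesis .
  qed
  then have "homs F ?G = {\<phi> \<in> verts F \<rightarrow>\<^sub>E {1..n}.
      \<forall>(i, j)\<in>ordered_edges F. \<phi> i \<noteq> \<phi> j \<and> W (I (\<phi> i)) (I (\<phi> j)) = 1}"
    unfolding homs_def verts_interval_graph by (intro Collect_cong conj_cong refl)
  also have "\<dots> = {\<phi> \<in> overlap_maps F n I. \<forall>(i, j)\<in>ordered_edges F. \<phi> i \<noteq> \<phi> j}"
    by (auto simp: overlap_maps_def)
  finally show ?thesis .
qed

text \<open>
  An overlap map that is not a homomorphism identifies the ends of some edge. For a fixed edge this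
  happens for at most a fraction \<open>1 / n\<close> of all maps.\<close>

lemma hom_density_interval_graph_bound:
  assumes n: "n \<ge> 1" and I: "\<And>i. i \<in> {1..n} \<Longrightarrow> I i \<in> intervals"
  shows "\<bar>hom_density F (interval_graph n (\<lambda>i. {fst (I i)..snd (I i)}))
      - interval_density F (empirical_measure n I)\<bar> \<le> card (ordered_edges F) / n"
proof -
  let ?G = "interval_graph n (\<lambda>i. {fst (I i)..snd (I i)})" and ?E = "ordered_edges F"
  let ?M = "verts F \<rightarrow>\<^sub>E {1..n}"
  define Z where "Z e = {\<phi> \<in> ?M. \<phi> (fst e) = \<phi> (snd e)}" for e
  have fin: "finite ?M" by (simp add: finite_PiE finite_verts)
  have pos: "0 < card ?M" using n by (simp add: card_PiE finite_verts)
  have sub: "overlap_maps F n I \<subseteq> ?M" "homs F ?G \<subseteq> overlap_maps F n I"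
    by (auto simp: overlap_maps_def homs_interval_graph)
  have finO: "finite (overlap_maps F n I)" "finite (homs F ?G)" "\<And>e. finite (Z e)"
    using sub fin by (auto simp: Z_def intro: finite_subset)
  have "overlap_maps F n I \<subseteq> homs F ?G \<union> (\<Union>e\<in>?E. Z e)"
  proof
    fix \<phi> assume "\<phi> \<in> overlap_maps F n I"
    then show "\<phi> \<in> homs F ?G \<union> (\<Union>e\<in>?E. Z e)"
      using sub(1) unfolding homs_interval_graph Z_def by (force simp del: PiE_iff)
  qed
  then have "card (overlap_maps F n I) \<le> card (homs F ?G \<union> (\<Union>e\<in>?E. Z e))"
    using finO by (intro card_mono) (auto simp: finite_ordered_edges)
  also have "\<dots> \<le> card (homs F ?G) + (\<Sum>e\<in>?E. card (Z e))"
    by (intro order.trans[OF card_Un_le] add_mono card_UN_le finite_ordered_edges order.refl)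
  finally have upper: "card (overlap_maps F n I) \<le> card (homs F ?G) + (\<Sum>e\<in>?E. card (Z e))" .
  have lower: "card (homs F ?G) \<le> card (overlap_maps F n I)"
    by (rule card_mono[OF finO(1) sub(2)])
  have Z: "card (Z e) / card ?M \<le> 1 / n" if "e \<in> ?E" for e
  proof -
    have "card (Z e) * n \<le> card ?M"
      using card_PiE_coincidence[OF finite_verts, of "{1..n}" "fst e" F "snd e"]
        ordered_edgesD[of "fst e" "snd e" F] that by (simp add: Z_def)
    then have "real (card (Z e)) * n \<le> card ?M"
      by (metis of_nat_le_iff of_nat_mult)
    then show ?thesis
      using n pos by (simp add: divide_simps)
  qed
  have "hom_density F ?G - interval_density F (empirical_measure n I)
      = - ((real (card (overlap_maps F n I)) - card (homs F ?G)) / card ?M)"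
    using interval_density_empirical_measure[where I = I and F = F, OF n I]
    by (simp add: hom_density_eq_card verts_interval_graph diff_divide_distrib)
  then have "\<bar>hom_density F ?G - interval_density F (empirical_measure n I)\<bar>
      = (real (card (overlap_maps F n I)) - card (homs F ?G)) / card ?M"
    using lower by simp
  also have "\<dots> \<le> (\<Sum>e\<in>?E. real (card (Z e))) / card ?M"
    using upper pos by (intro divide_right_mono) (auto simp flip: of_nat_sum of_nat_add)
  also have "\<dots> = (\<Sum>e\<in>?E. card (Z e) / card ?M)"
    by (rule sum_divide_distrib)
  also have "\<dots> \<le> card ?E / n"
    using sum_mono[of ?E _ "\<lambda>_. 1 / real n", OF Z] by simp
  finally show ?thesis .
qed

text \<open>
  The convergence of densities already provides the witness needed for the densities of \<open>\<mu>\<close> to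
  belong to a graph limit, so the description in \<open>interval_limit\<close> denotes.\<close>

lemma converges_to_interval_limit:
  assumes "filterlim (\<lambda>n. graph_order (G n)) at_top sequentially"
    and "\<And>F. (\<lambda>n. hom_density F (G n)) \<longlonglongrightarrow> interval_density F \<mu>"
  shows "converges_to G (interval_limit \<mu>)"
proof -
  define \<Gamma> where "\<Gamma> = Abs_graph_limit (\<lambda>F. interval_density F \<mu>)"
  have \<Gamma>: "limit_density F \<Gamma> = interval_density F \<mu>" for F
    unfolding \<Gamma>_def limit_density_def using assms by (subst Abs_graph_limit_inverse) auto
  have "interval_limit \<mu> = \<Gamma>"
    unfolding interval_limit_def by (rule the_equality) (auto simp: \<Gamma> intro: graph_limit_eqI)
  then show ?thesis
    using assms \<Gamma> by (simp add: converges_to_def)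
qed

theorem theorem3p2:
  fixes a b :: "nat \<Rightarrow> nat \<Rightarrow> real"
    and G :: "nat \<Rightarrow> graph"
    and \<mu> :: "(real \<times> real) measure"
  assumes "\<And>n i. i \<in> {1..n} \<Longrightarrow> 0 \<le> a n i \<and> a n i \<le> b n i \<and> b n i \<le> 1"
    and "\<And>n. G n = interval_graph n (\<lambda>i. {a n i..b n i})"
    and "\<mu> \<in> space (prob_algebra borel_intervals)"
    and "converges_weakly (\<lambda>n. empirical_measure n (\<lambda>i. (a n i, b n i))) \<mu>"
    and "\<not> (\<exists>c. common_atom \<mu> c)"
  shows "converges_to G (interval_limit \<mu>)"
proof (rule converges_to_interval_limit)
  have "graph_order (G n) = n" for n
    by (simp add: assms(2) graph_order_def verts_interval_graph)
  then show "filterlim (\<lambda>n. graph_order (G n)) at_top sequentially"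
    by (simp add: filterlim_ident)
next
  fix F
  let ?\<mu> = "\<lambda>n. empirical_measure n (\<lambda>i. (a n i, b n i))"
  have I: "(a n i, b n i) \<in> intervals" if "i \<in> {1..n}" for n i
    using assms(1)[OF that] by (simp add: intervals_def)
  \<comment> \<open>The empirical measure of no points is not a probability measure,
    so the sequence is shifted by one.\<close>
  have "converges_weakly (\<lambda>n. ?\<mu> (Suc n)) \<mu>"
    unfolding converges_weakly_def
    by (intro allI impI LIMSEQ_Suc) (use assms(4) in \<open>auto simp: converges_weakly_def\<close>)
  then have "(\<lambda>n. interval_density F (?\<mu> (Suc n))) \<longlonglongrightarrow> interval_density F \<mu>"
    using I by (intro tendsto_interval_density empirical_measure_prob assms(3,5)) auto
  then have lim: "(\<lambda>n. interval_density F (?\<mu> n)) \<longlonglongrightarrow> interval_density F \<mu>"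
    by (rule LIMSEQ_imp_Suc)
  have "\<bar>hom_density F (G n) - interval_density F (?\<mu> n)\<bar> \<le> card (ordered_edges F) / n"
    if "n \<ge> 1" for n
    using hom_density_interval_graph_bound[OF that, of "\<lambda>i. (a n i, b n i)" F] I
    by (simp add: assms(2))
  then have "\<forall>\<^sub>F n in sequentially.
      norm (hom_density F (G n) - interval_density F (?\<mu> n)) \<le> card (ordered_edges F) / n"
    by (auto simp: eventually_sequentially)
  then have "(\<lambda>n. hom_density F (G n) - interval_density F (?\<mu> n)) \<longlonglongrightarrow> 0"
    by (rule Lim_null_comparison) (rule lim_const_over_n)
  from tendsto_add[OF this lim]
  show "(\<lambda>n. hom_density F (G n)) \<longlonglongrightarrow> interval_density F \<mu>"
    by simp
qed

end
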